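(* Let $W=(w(n))_{n\geq 1}$ be the infinite sequence over $\{1,2\}$ defined in the context and let $\theta=\sum_{n\geq 1}w(n)T^{-n}\in \mathbb{Q}((T^{-1}))$. Then the irrationality measure of $\theta$ is equal to $3$, i.e. $\nu(\theta)=3$.
   Context: Define finite words over the alphabet $\{1,2\}$ recursively by $W_0=\epsilon$ (the empty word), $W_1=1$, and $W_n=W_{n-1}\,2\,W_{n-2}\,2\,W_{n-1}$ (concatenation) for $n\geq 2$. Each $W_n$ is a prefix of $W_{n+1}$, and $W=(w(n))_{n\geq 1}$ is the infinite sequence that begins with $W_n$ for every $n\geq 0$. $\mathbb{Q}((T^{-1}))$ is the field of formal power series in $1/T$ over $\mathbb{Q}$, whose nonzero elements are $\alpha=\sum_{k\leq k_0}c_kT^k$ with $k_0\in\mathbb{Z}$, $c_k\in\mathbb{Q}$, $c_{k_0}\neq 0$. It carries the ultrametric absolute value $|\alpha|=|T|^{k_0}$ (and $|0|=0$), where $|T|>1$ is a fixed real number. The irrationality measure of an irrational $\alpha\in\mathbb{Q}((T^{-1}))$ (i.e. $\alpha\notin\mathbb{Q}(T)$) is \[ \nu(\alpha)=\limsup_{|Q|\to\infty}\left(-\frac{\log|\alpha-P/Q|}{\log|Q|}\right), \] where $P,Q\in\mathbb{Q}[T]$, $Q\ne 0$. Equivalently, if $\alpha=[a_0,a_1,a_2,\dots]$ is the continued fraction expansion of $\alpha$ (partial quotients in $\mathbb{Q}[T]$, of positive degree for indices $\ge 1$), then $\nu(\alpha)=2+\limsup_{n\geq 1}\big(\deg(a_{n+1})/\sum_{1\leq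 i\leq n}\deg(a_i)\big)$. *)

theory Defs
  imports "HOL-Computational_Algebra.Computational_Algebra" "HOL-Library.Extended_Real"
    "HOL-Library.Liminf_Limsup" "HOL-Library.Sublist"
begin

fun W :: "nat \<Rightarrow> nat list" where
  "W 0 = []"
| "W (Suc 0) = [1]"
| "W (Suc (Suc n)) = W (Suc n) @ [2] @ W n @ [2] @ W (Suc n)"

lemma prefix_W_Suc: "prefix (W n) (W (Suc n))"
  by (cases n) auto

lemma prefix_W: "m \<le> n \<Longrightarrow> prefix (W m) (W n)"
  by (induction n rule: dec_induct) (auto intro: prefix_order.trans prefix_W_Suc)

lemma length_W_ge: "n \<le> length (W n)"
  by (induction n rule: W.induct) auto

text \<open>The infinite sequence is indexed from 1; its value at index 0 is meaningless. Since
  \<open>W n\<close> has length at least \<open>n\<close>, its \<open>n\<close>-th letter is defined.\<close>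

definition w :: "nat \<Rightarrow> nat" where
  "w n = W n ! (n - 1)"

lemma w_begins_with_W: "map w [1..<Suc (length (W n))] = W n"
proof (rule nth_equalityI)
  fix i assume "i < length (map w [1..<Suc (length (W n))])"
  then have i: "i < length (W n)" by (simp del: upt_Suc)
  have i': "i < length (W (Suc i))"
    using length_W_ge[of "Suc i"] by simp
  have "W (Suc i) ! i = W n ! i"
    using prefix_W[of n "Suc i"] prefix_W[of "Suc i" n] i i'
    by (cases "n \<le> Suc i") (auto simp: prefix_def nth_append)
  then show "map w [1..<Suc (length (W n))] ! i = W n ! i"
    using i by (simp add: w_def del: upt_Suc)
qed (simp del: upt_Suc)

text \<open>The field of formal series in \<open>1/T\<close> over the rationals is \<open>rat fls\<close>, with the variable
  \<^const>\<open>fls_X\<close> standing for \<open>1/T\<close> and hence \<^const>\<open>fls_X_inv\<close> for \<open>T\<close>: the coefficient of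
  \<open>T\<close> to the power \<open>k\<close> in \<open>f\<close> is \<open>fls_nth f (- k)\<close>. In particular the degree in \<open>T\<close> of a nonzero
  series is \<open>- fls_subdegree\<close>.\<close>

definition poly_T :: "rat poly \<Rightarrow> rat fls" where
  "poly_T P = poly (map_poly fls_const P) fls_X_inv"

lemma fls_nth_poly_T: "fls_nth (poly_T P) k = (if k \<le> 0 then coeff P (nat (- k)) else 0)"
proof (induction P arbitrary: k)
  case 0
  then show ?case by (simp add: poly_T_def)
next
  case (pCons a P)
  have "poly_T (pCons a P) = fls_const a + fls_X_inv * poly_T P"
    using pCons.hyps by (simp add: poly_T_def map_poly_pCons)
  then show ?case
    using pCons.IH
    by (auto simp: fls_X_inv_times_conv_shift coeff_pCons nat_diff_distrib Suc_nat_eq_nat_zadd1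
        intro!: arg_cong[of _ _ "coeff P"] split: nat.split)
qed

text \<open>The parameter \<open>b > 1\<close> is the fixed real number denoted \<open>|T|\<close>.\<close>

definition absT :: "real \<Rightarrow> rat fls \<Rightarrow> real" where
  "absT b f = (if f = 0 then 0 else b powi (- fls_subdegree f))"

definition rational_functions :: "rat fls set" where
  "rational_functions = {poly_T P / poly_T Q | P Q. Q \<noteq> 0}"

text \<open>The upper limit runs over all pairs \<open>(P, Q)\<close> of polynomials as \<open>|Q|\<close> tends to infinity, so
  \<open>Q \<noteq> 0\<close> holds eventually. It is only meant for irrational \<open>f\<close>, for which the argument of the
  first logarithm is never 0.\<close>

definition irrationality_measure :: "real \<Rightarrow> rat fls \<Rightarrow> ereal" where
  "irrationality_measure b f =
     Limsup (filtercomap (\<lambda>(P, Q). absT b (poly_T Q)) at_top)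
       (\<lambda>(P, Q). ereal (- (ln (absT b (f - poly_T P / poly_T Q)) / ln (absT b (poly_T Q)))))"

definition theta :: "rat fls" where
  "theta = fps_to_fls (Abs_fps (\<lambda>n. if n = 0 then 0 else of_nat (w n)))"

end

theory Submission
  imports Defs
begin

text \<open>Put \<open>V n = W n 2\<close>, so that \<open>V (n+2) = V (n+1) V n V (n+1)\<close>, and let \<open>d n\<close> be one more
  than the sum of the lengths of \<open>V 0, ..., V n\<close>. The words \<open>V (n+1) V n\<close> and \<open>V n V (n+1)\<close> have
  equal length; their longest common prefix has length \<open>d n - 2\<close>, and they share a suffix of length
  \<open>d n - 1\<close>. Hence, in the prefix \<open>V (n+3)\<close> of the infinite word, the cube of \<open>V (n+1)\<close> extends
  in both directions to a repetition that turns into a fraction with denominator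
  \<open>T^d (n+1) - T^d n\<close> at distance \<open>|T|^-(3 d (n+1) - 2)\<close> from theta. So the measure is at least 3.

  Conversely, two distinct fractions with denominators of degrees \<open>q\<close> and \<open>q'\<close> are at distance at
  least \<open>|T|^-(q + q')\<close>. Since \<open>d (n+1)\<close> is at most about \<open>3 d n\<close>, comparison with this family
  bounds the quality of every fraction outside the family. A member of the family might not be in
  lowest terms; comparing it with a second family, with denominators \<open>T^(2 d n - 1) - 1\<close>, shows
  that cancellation lowers the degree \<open>d (n+1)\<close> of its denominator by at most 1.\<close>

section \<open>Repetitions in the infinite word\<close>

definition V :: "nat \<Rightarrow> nat list" where
  "V n = W n @ [2]"

lemma V_0: "V 0 = [2]" and V_1: "V (Suc 0) = [1, 2]"
  by (simp_all add: V_def)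

lemma V_rec: "V (Suc (Suc n)) = V (Suc n) @ V n @ V (Suc n)"
  by (simp add: V_def)

text \<open>For positive n the 2 appended to \<open>W n\<close> is the separator that follows
  \<open>W n\<close> inside \<open>W (Suc n)\<close>. For n = 0 this fails:
  \<open>V 0 = [2]\<close>, but the word starts with 1.\<close>

lemma w_eq_nth_V:
  assumes "0 < n" and "i < length (V n)"
  shows "w (Suc i) = V n ! i"
proof -
  have "prefix (V n) (W (Suc n) @ [2])"
    using assms(1) by (cases n) (auto simp: V_def)
  then obtain zs where zs: "W (Suc n) @ [2] = V n @ zs"
    by (auto simp: prefix_def)
  have "length (W n) < length (W (Suc n))"
    by (cases n) auto
  with assms(2) have i: "i < length (W (Suc n))"
    by (simp add: V_def)
  have "w (Suc i) = map w [1..<Suc (length (W (Suc n)))] ! i"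
    using i by (simp del: upt_Suc)
  also have "\<dots> = (W (Suc n) @ [2]) ! i"
    using i by (simp only: w_begins_with_W) (simp add: nth_append)
  also have "\<dots> = V n ! i"
    using assms(2) by (simp add: zs nth_append)
  finally show ?thesis .
qed

text \<open>Transfers two occurrences of a block \<open>A\<close> to the 1-based sequence
  \<open>w\<close>: the letters agree along \<open>A\<close>, and the next ones are \<open>x\<close>
  and \<open>x'\<close>.\<close>

lemma w_shift:
  assumes "V N = Y @ A @ x # Z" and "V N = Y' @ A @ x' # Z'" and "0 < N"
  shows "i < length A \<Longrightarrow> w (Suc (length Y + i)) = w (Suc (length Y' + i))"
    and "w (Suc (length Y + length A)) = x"
    and "w (Suc (length Y' + length A)) = x'"
proof -
  have len: "length (V N) = length Y + length A + length Z + 1"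
    "length (V N) = length Y' + length A + length Z' + 1"
    using arg_cong[OF assms(1), of length] arg_cong[OF assms(2), of length] by simp_all
  show "w (Suc (length Y + i)) = w (Suc (length Y' + i))" if "i < length A"
  proof -
    have "w (Suc (length Y + i)) = A ! i"
      using that len assms(3) by (subst w_eq_nth_V[of N]) (simp_all add: assms(1) nth_append)
    moreover have "w (Suc (length Y' + i)) = A ! i"
      using that len assms(3) by (subst w_eq_nth_V[of N]) (simp_all add: assms(2) nth_append)
    ultimately show ?thesis by simp
  qed
  show "w (Suc (length Y + length A)) = x"
    using len assms(3) by (subst w_eq_nth_V[of N]) (simp_all add: assms(1) nth_append)
  show "w (Suc (length Y' + length A)) = x'"
    using len assms(3) by (subst w_eq_nth_V[of N]) (simp_all add: assms(2) nth_append)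
qed

section \<open>Lengths, and how far \<open>V (n+1)\<close> and \<open>V n\<close> commute\<close>

definition d :: "nat \<Rightarrow> nat" where
  "d n = Suc (\<Sum>i\<le>n. length (V i))"

lemma d_Suc: "d (Suc n) = d n + length (V (Suc n))"
  by (simp add: d_def)

text \<open>Both sides grow by twice the length of \<open>V (Suc n)\<close>. The identity converts
  lengths of words into values of \<open>d\<close>.\<close>

lemma double_d: "2 * d n = length (V (Suc n)) + length (V n) + 1"
proof (induction n)
  case 0
  then show ?case by (simp add: d_def V_0 V_1)
next
  case (Suc n)
  then show ?case by (simp add: d_Suc V_rec)
qed

lemma length_V_ge: "n < length (V n)"
  using length_W_ge[of n] by (simp add: V_def)

lemma d_ge: "n + 2 \<le> d n"
proof (induction n)
  case 0
  then show ?case by (simp add: d_def V_0)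
next
  case (Suc n)
  then show ?case using length_V_ge[of "Suc n"] by (simp add: d_Suc)
qed

text \<open>In the induction step, cancelling a leading \<open>V (Suc n)\<close> leaves the previous
  pair of words with the roles of \<open>x\<close> and \<open>y\<close> exchanged, so
  \<open>C\<close> gains \<open>V (Suc n)\<close> in front.\<close>

lemma V_common_prefix:
  "\<exists>C x y. prefix (C @ [x]) (V (Suc n)) \<and> prefix (C @ [y]) (V n @ V (Suc n)) \<and> x \<noteq> y \<and>
     length C + 2 = d n"
proof (induction n)
  case 0
  have "prefix ([] @ [1]) (V (Suc 0)) \<and> prefix ([] @ [2]) (V 0 @ V (Suc 0)) \<and> (1::nat) \<noteq> 2 \<and>
      length ([] :: nat list) + 2 = d 0"
    by (simp add: V_0 V_1 d_def)
  then show ?case by blast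
next
  case (Suc n)
  then obtain C x y where C: "prefix (C @ [x]) (V (Suc n))" "prefix (C @ [y]) (V n @ V (Suc n))"
    "x \<noteq> y" "length C + 2 = d n"
    by blast
  have "prefix ((V (Suc n) @ C) @ [y]) (V (Suc (Suc n)))"
    using C(2) by (simp add: V_rec)
  moreover have "prefix ((V (Suc n) @ C) @ [x]) (V (Suc n) @ V (Suc (Suc n)))"
    using C(1) by (simp add: V_rec prefix_prefix)
  ultimately show ?case
    using C(3,4) by (intro exI[of _ "V (Suc n) @ C"] exI[of _ x] exI[of _ y]) (auto simp: d_Suc)
qed

text \<open>Mirror image of the prefix argument: removing a final \<open>V (Suc n)\<close> from both
  products exposes the previous pair, so \<open>E\<close> gains \<open>V (Suc n)\<close> at the
  end.\<close>

lemma V_common_suffix: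
  "\<exists>E. suffix E (V (Suc n) @ V n) \<and> suffix E (V n @ V (Suc n)) \<and> length E + 1 = d n"
proof (induction n)
  case 0
  show ?case
    by (intro exI[of _ "[2]"]) (simp add: V_0 V_1 d_def suffix_def)
next
  case (Suc n)
  then obtain E where E: "suffix E (V (Suc n) @ V n)" "suffix E (V n @ V (Suc n))"
    "length E + 1 = d n"
    by blast
  then obtain us vs where "V (Suc n) @ V n = us @ E" "V n @ V (Suc n) = vs @ E"
    by (auto simp: suffix_def)
  note eq = this
  have "V (Suc (Suc n)) @ V (Suc n) = V (Suc n) @ (V n @ V (Suc n)) @ V (Suc n)"
    by (simp add: V_rec)
  also have "\<dots> = (V (Suc n) @ vs) @ E @ V (Suc n)"
    unfolding eq by simp
  finally have 1: "V (Suc (Suc n)) @ V (Suc n) = (V (Suc n) @ vs) @ E @ V (Suc n)" .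
  have "V (Suc n) @ V (Suc (Suc n)) = V (Suc n) @ (V (Suc n) @ V n) @ V (Suc n)"
    by (simp add: V_rec)
  also have "\<dots> = (V (Suc n) @ us) @ E @ V (Suc n)"
    unfolding eq by simp
  finally show ?case
    using 1 E(3) by (intro exI[of _ "E @ V (Suc n)"] conjI suffixI) (assumption | simp add: d_Suc)+
qed

section \<open>Two repetitions inside \<open>V (n + 3)\<close>\<close>

lemma V_factorization_1:
  "\<exists>A Y Y' x x' Z Z'. V (n + 3) = Y @ A @ x # Z \<and> V (n + 3) = Y' @ A @ x' # Z' \<and> x \<noteq> x' \<and>
     length Y = d n \<and> length Y' = d (Suc n) \<and> length A + 3 = 2 * d (Suc n)"
proof -
  define U where "U = V (Suc n)"
  obtain C x y where "prefix (C @ [x]) U" "prefix (C @ [y]) (V n @ U)" "x \<noteq> y" "length C + 2 = d n"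
    using V_common_prefix[of n] unfolding U_def by blast
  then obtain u v where C: "U = C @ x # u" "V n @ U = C @ y # v" "x \<noteq> y" "length C + 2 = d n"
    by (auto simp: prefix_def)
  obtain E where "suffix E (U @ V n)" "suffix E (V n @ U)" "length E + 1 = d n"
    using V_common_suffix[of n] unfolding U_def by blast
  then obtain p q where E: "U @ V n = p @ E" "V n @ U = q @ E" "length E + 1 = d n"
    by (auto simp: suffix_def)
  have V3: "V (n + 3) = U @ V n @ U @ U @ U @ V n @ U"
    by (simp add: U_def V_rec numeral_3_eq_3)
  have "V (n + 3) = (U @ V n) @ U @ U @ U @ V n @ U"
    by (simp add: V3)
  \<comment> \<open>First occurrence: \<open>E\<close> ends just before the cube
    \<open>U @ U @ U\<close>, and \<open>C\<close> followed by \<open>x\<close> opens its third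
    copy.\<close>
  also have "\<dots> = p @ E @ U @ U @ (C @ x # u) @ V n @ U"
    unfolding E(1) by (simp flip: C(1))
  finally have 1: "V (n + 3) = p @ (E @ U @ U @ C) @ x # u @ V n @ U"
    by simp
  \<comment> \<open>Second occurrence, shifted by the length of \<open>U\<close>: \<open>E\<close>
    ends with the first copy of the cube, and \<open>C\<close> followed by \<open>y\<close> opens
    the word after it.\<close>
  have "V (n + 3) = U @ (V n @ U) @ U @ U @ (V n @ U)"
    by (simp add: V3)
  also have "\<dots> = U @ (q @ E) @ U @ U @ (C @ y # v)"
    by (simp only: C(2) flip: E(2))
  finally have 2: "V (n + 3) = (U @ q) @ (E @ U @ U @ C) @ y # v"
    by simp
  have "length U + length (V n) = length p + length E" "length U + length (V n) = length q + length E"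
    using arg_cong[OF E(1), of length] arg_cong[OF E(2), of length] by simp_all
  then have "length p = d n" "length (U @ q) = d (Suc n)" "length (E @ U @ U @ C) + 3 = 2 * d (Suc n)"
    using C(4) E(3) double_d[of n] d_Suc[of n] by (simp_all add: U_def)
  then show ?thesis
    using 1 2 C(3) by blast
qed

text \<open>Here the repetition has period \<open>U @ V n\<close> and starts at the first letter:
  \<open>U @ C\<close> recurs after one period, because \<open>V n @ U\<close> and \<open>U\<close>
  both begin with \<open>C\<close>.\<close>

lemma V_factorization_2:
  "\<exists>A Y' x x' Z Z'. V (n + 3) = A @ x # Z \<and> V (n + 3) = Y' @ A @ x' # Z' \<and> x \<noteq> x' \<and>
     length Y' + 1 = 2 * d n \<and> length A + 2 = d (Suc n)"
proof -
  define U where "U = V (Suc n)"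
  obtain C x y where "prefix (C @ [x]) U" "prefix (C @ [y]) (V n @ U)" "x \<noteq> y" "length C + 2 = d n"
    using V_common_prefix[of n] unfolding U_def by blast
  then obtain u v where C: "U = C @ x # u" "V n @ U = C @ y # v" "x \<noteq> y" "length C + 2 = d n"
    by (auto simp: prefix_def)
  have V3: "V (n + 3) = U @ V n @ U @ U @ U @ V n @ U"
    by (simp add: U_def V_rec numeral_3_eq_3)
  have "V (n + 3) = U @ (V n @ U) @ U @ U @ V n @ U"
    by (simp add: V3)
  also have "\<dots> = (U @ C) @ y # v @ U @ U @ V n @ U"
    unfolding C(2) by simp
  finally have 1: "V (n + 3) = (U @ C) @ y # v @ U @ U @ V n @ U" .
  have "V (n + 3) = (U @ V n) @ (U @ (C @ x # u)) @ U @ V n @ U"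
    unfolding V3 by (simp flip: C(1))
  then have 2: "V (n + 3) = (U @ V n) @ (U @ C) @ x # u @ U @ V n @ U"
    by simp
  have "length (U @ V n) + 1 = 2 * d n" "length (U @ C) + 2 = d (Suc n)"
    using C(4) double_d[of n] d_Suc[of n] by (simp_all add: U_def)
  then show ?thesis
    using 1 2 C(3) by blast
qed


section \<open>Rational approximations\<close>

lemma poly_T_0 [simp]: "poly_T 0 = 0"
  by (simp add: poly_T_def)

lemma poly_T_pCons: "poly_T (pCons a P) = fls_const a + fls_X_inv * poly_T P"
  by (cases "a = 0 \<and> P = 0") (auto simp: poly_T_def map_poly_pCons)

lemma poly_T_add: "poly_T (P + Q) = poly_T P + poly_T Q"
  by (rule fls_eqI) (simp add: fls_nth_poly_T)

lemma poly_T_smult: "poly_T (smult a P) = fls_const a * poly_T P"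
  by (rule fls_eqI) (simp add: fls_nth_poly_T)

lemma poly_T_mult: "poly_T (P * Q) = poly_T P * poly_T Q"
  by (induction P) (simp_all add: poly_T_pCons poly_T_add poly_T_smult algebra_simps)

lemma poly_T_diff: "poly_T (P - Q) = poly_T P - poly_T Q"
  by (rule fls_eqI) (simp add: fls_nth_poly_T)

lemma poly_T_monom: "poly_T (monom 1 n) = fls_X_inv ^ n"
  by (simp add: poly_T_def map_poly_monom poly_monom)

lemma poly_T_eq_0_iff [simp]: "poly_T P = 0 \<longleftrightarrow> P = 0"
proof
  assume "poly_T P = 0"
  then have "fls_nth (poly_T P) (- int k) = 0" for k
    by simp
  then show "P = 0"
    by (intro poly_eqI) (simp add: fls_nth_poly_T)
qed simp

lemma fls_subdegree_poly_T: "fls_subdegree (poly_T P) = - int (degree P)"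
proof (cases "P = 0")
  case False
  then show ?thesis
    by (intro fls_subdegree_eqI) (auto simp: fls_nth_poly_T coeff_eq_0)
qed simp

lemma fls_subdegree_divide_field:
  fixes f g :: "'a::field fls"
  assumes "f \<noteq> 0" "g \<noteq> 0"
  shows "fls_subdegree (f / g) = fls_subdegree f - fls_subdegree g"
proof -
  have "fls_subdegree (f / g * g) = fls_subdegree (f / g) + fls_subdegree g"
    using assms by (intro fls_subdegree_mult) auto
  then show ?thesis using assms by simp
qed

text \<open>Over a common denominator the two fractions differ by a nonzero polynomial numerator. As
  \<open>f\<close> is closer to A/B than this difference, the ultrametric inequality keeps it away
  from P/Q.\<close>

lemma fls_subdegree_diff_fractions:
  assumes "B \<noteq> 0" "Q \<noteq> 0" "poly_T P / poly_T Q \<noteq> poly_T A / poly_T B"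
    and "f \<noteq> poly_T P / poly_T Q"
    and "int (degree B + degree Q) < fls_subdegree (f - poly_T A / poly_T B)"
  shows "fls_subdegree (f - poly_T P / poly_T Q) \<le> int (degree B + degree Q)"
proof -
  let ?N = "P * B - A * Q"
  have eq: "(f - poly_T A / poly_T B) - (f - poly_T P / poly_T Q) = poly_T ?N / poly_T (B * Q)"
    using assms(1,2) by (simp add: poly_T_mult poly_T_diff field_simps)
  have N: "?N \<noteq> 0"
    using eq assms(3) by auto
  have "fls_subdegree (poly_T ?N / poly_T (B * Q)) \<le> int (degree B + degree Q)"
    using N assms(1,2) by (simp add: fls_subdegree_divide_field fls_subdegree_poly_T degree_mult_eq)
  moreover have "poly_T ?N / poly_T (B * Q) \<noteq> 0"
    using N assms(1,2) by simp
  ultimately show ?thesis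
    using fls_subdegree_minus[of "f - poly_T A / poly_T B" "f - poly_T P / poly_T Q"]
      assms(5) unfolding eq by linarith
qed

lemma theta_nth: "fls_nth theta k = (if k \<le> 0 then 0 else of_nat (w (nat k)))"
  by (auto simp: theta_def)

lemma theta_approximation:
  assumes "V N = Y @ A @ x # Z" and "V N = Y' @ A @ x' # Z'" and "x \<noteq> x'"
    and "length Y < length Y'" and "0 < N"
  shows "\<exists>P Q. Q \<noteq> 0 \<and> degree Q = length Y' \<and> theta - poly_T P / poly_T Q \<noteq> 0 \<and>
    fls_subdegree (theta - poly_T P / poly_T Q) = int (length Y' + length A + 1)"
proof -
  let ?a = "length Y" and ?b = "length Y'"
  define Q :: "rat poly" where "Q = monom 1 ?b - monom 1 ?a"
  \<comment> \<open>The polynomial part of \<open>theta * poly_T Q\<close>; terms of degree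
    \<open>?b\<close> or more vanish, so the sum misses nothing.\<close>
  define P where "P = (\<Sum>j\<le>?b. monom (fls_nth (theta * poly_T Q) (- int j)) j)"
  define h where "h = theta * poly_T Q - poly_T P"
  have "degree Q = ?b"
    unfolding Q_def using assms(4)
    by (intro antisym degree_diff_le le_degree) (auto simp: degree_monom_eq)
  moreover from this assms(4) have Q0: "Q \<noteq> 0"
    by auto
  have thQ: "fls_nth (theta * poly_T Q) k = fls_nth theta (k + int ?b) - fls_nth theta (k + int ?a)" for k
    by (simp add: Q_def poly_T_diff poly_T_monom right_diff_distrib fls_X_inv_power_times_conv_shift)
  have P: "coeff P i = (if i \<le> ?b then fls_nth (theta * poly_T Q) (- int i) else 0)" for i
    by (simp add: P_def coeff_sum)
  have h: "fls_nth h k = (if k \<le> 0 then 0 else of_nat (w (nat k + ?b)) - of_nat (w (nat k + ?a)))" for k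
  proof (cases "k \<le> 0")
    case True
    then show ?thesis
      using assms(4) by (auto simp: h_def fls_nth_poly_T P thQ theta_nth)
  next
    case False
    then show ?thesis
      by (simp add: h_def fls_nth_poly_T thQ theta_nth nat_add_distrib)
  qed
  note shift = w_shift[OF assms(1,2,5)]
  \<comment> \<open>The coefficient of \<open>h\<close> at T^-k compares the k-th letters from the
    two offsets; they first differ just after \<open>A\<close>.\<close>
  have lead: "fls_nth h (int (length A) + 1) \<noteq> 0"
    using shift(2,3) assms(3) by (simp add: h nat_add_distrib add.commute)
  have zero: "fls_nth h k = 0" if k: "k < int (length A) + 1" for k
  proof (cases "k \<le> 0")
    case False
    define i where "i = nat k - 1"
    have "i < length A" "nat k = Suc i"
      using k False by (auto simp: i_def)
    then show ?thesis
      using shift(1)[of i] False by (simp add: h add.commute)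
  qed (simp add: h)
  have sub: "fls_subdegree h = int (length A) + 1"
    by (intro fls_subdegree_eqI lead zero)
  have "h \<noteq> 0"
    using lead by auto
  have eq: "theta - poly_T P / poly_T Q = h / poly_T Q"
    using Q0 by (simp add: h_def field_simps)
  have "theta - poly_T P / poly_T Q \<noteq> 0"
    "fls_subdegree (theta - poly_T P / poly_T Q) = int (length Y' + length A + 1)"
    unfolding eq using Q0 \<open>h \<noteq> 0\<close> \<open>degree Q = ?b\<close>
    by (simp_all add: fls_subdegree_divide_field fls_subdegree_poly_T sub)
  with Q0 \<open>degree Q = ?b\<close> show ?thesis by blast
qed

lemma theta_approximation_1:
  "\<exists>P Q. Q \<noteq> 0 \<and> degree Q = d (Suc n) \<and> theta - poly_T P / poly_T Q \<noteq> 0 \<and>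
    fls_subdegree (theta - poly_T P / poly_T Q) = 3 * int (d (Suc n)) - 2"
proof -
  obtain A Y Y' x x' Z Z' where f: "V (n + 3) = Y @ A @ x # Z" "V (n + 3) = Y' @ A @ x' # Z'"
    "x \<noteq> x'" and len: "length Y = d n" "length Y' = d (Suc n)" "length A + 3 = 2 * d (Suc n)"
    using V_factorization_1[of n] by blast
  have "length Y < length Y'"
    using len length_V_ge[of "Suc n"] by (auto simp: d_Suc)
  moreover have "int (length Y' + length A + 1) = 3 * int (d (Suc n)) - 2"
    using len by linarith
  ultimately show ?thesis
    using theta_approximation[OF f] len(2) by (metis add_gr_0 zero_less_numeral)
qed

lemma theta_approximation_2:
  "\<exists>P Q. Q \<noteq> 0 \<and> degree Q = 2 * d n - 1 \<and> theta - poly_T P / poly_T Q \<noteq> 0 \<and>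
    fls_subdegree (theta - poly_T P / poly_T Q) = 2 * int (d n) + int (d (Suc n)) - 2"
proof -
  obtain A Y' x x' Z Z' where f: "V (n + 3) = [] @ A @ x # Z" "V (n + 3) = Y' @ A @ x' # Z'"
    "x \<noteq> x'" and len: "length Y' + 1 = 2 * d n" "length A + 2 = d (Suc n)"
    using V_factorization_2[of n] by (metis append_Nil)
  have "length [] < length Y'"
    using len d_ge[of n] by (cases Y') auto
  moreover have "int (length Y' + length A + 1) = 2 * int (d n) + int (d (Suc n)) - 2"
    using len by linarith
  moreover have "length Y' = 2 * d n - 1"
    using len by simp
  ultimately show ?thesis
    using theta_approximation[OF f] by (metis add_gr_0 zero_less_numeral)
qed

lemma theta_irrational: "theta \<notin> rational_functions"
proof
  assume "theta \<in> rational_functions"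
  then obtain P Q where Q: "Q \<noteq> 0" and th: "theta = poly_T P / poly_T Q"
    by (auto simp: rational_functions_def)
  \<comment> \<open>Any index with \<open>2 * d\<close> above \<open>degree Q + 2\<close>
    contradicts the lower bound for the distance of distinct fractions; \<open>d_ge\<close> makes
    this one large enough.\<close>
  obtain A B where B: "B \<noteq> 0" "degree B = d (Suc (degree Q))" "theta - poly_T A / poly_T B \<noteq> 0"
    and e: "fls_subdegree (theta - poly_T A / poly_T B) = 3 * int (d (Suc (degree Q))) - 2"
    using theta_approximation_1 by blast
  have eq: "theta - poly_T A / poly_T B = poly_T (P * B - A * Q) / poly_T (Q * B)"
    using Q B(1) by (simp add: th poly_T_mult poly_T_diff field_simps)
  then have "P * B - A * Q \<noteq> 0"
    using B(3) by auto
  then have "fls_subdegree (theta - poly_T A / poly_T B) \<le> int (degree Q + degree B)"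
    unfolding eq using Q B(1)
    by (simp add: fls_subdegree_divide_field fls_subdegree_poly_T degree_mult_eq)
  then show False
    using e B(2) d_ge[of "Suc (degree Q)"] by simp
qed

lemma theta_approximation_bound:
  assumes "Q \<noteq> 0"
  shows "fls_subdegree (theta - poly_T P / poly_T Q) \<le> 3 * int (degree Q) + 4"
proof -
  let ?q = "degree Q" and ?e = "fls_subdegree (theta - poly_T P / poly_T Q)"
  have irr: "theta \<noteq> poly_T P / poly_T Q"
    using assms theta_irrational by (auto simp: rational_functions_def)
  \<comment> \<open>The condition says \<open>d (Suc n) + ?q < 3 * d (Suc n) - 2\<close>, as needed
    to compare with the first family.\<close>
  define n where "n = (LEAST n. ?q + 2 < 2 * d (Suc n))"
  have "?q + 2 < 2 * d (Suc ?q)"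
    using d_ge[of "Suc ?q"] by simp
  then have n: "?q + 2 < 2 * d (Suc n)"
    unfolding n_def by (rule LeastI)
  \<comment> \<open>The 8 comes from n = 0, where \<open>d 1 = 4\<close>. Otherwise minimality
    bounds \<open>2 * d n\<close>, and \<open>d (Suc n) < 3 * d n\<close>.\<close>
  have dn: "2 * d (Suc n) \<le> 3 * ?q + 8"
  proof (cases n)
    case 0
    then show ?thesis by (simp add: d_def V_0 V_1)
  next
    case (Suc m)
    then have "2 * d n \<le> ?q + 2"
      using not_less_Least[of m "\<lambda>n. ?q + 2 < 2 * d (Suc n)"] unfolding n_def[symmetric] by simp
    then show ?thesis
      using double_d[of n] d_Suc[of n] by simp
  qed
  obtain A B where B: "B \<noteq> 0" "degree B = d (Suc n)"
    and e: "fls_subdegree (theta - poly_T A / poly_T B) = 3 * int (d (Suc n)) - 2"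
    using theta_approximation_1 by blast
  show ?thesis
  proof (cases "poly_T P / poly_T Q = poly_T A / poly_T B")
    case False
    have "?e \<le> int (degree B + ?q)"
      using B e n by (intro fls_subdegree_diff_fractions[OF B(1) assms False irr]) simp
    then show ?thesis
      using B(2) dn by simp
  next
    case True
    obtain A' B' where B': "B' \<noteq> 0" "degree B' = 2 * d n - 1"
      and e': "fls_subdegree (theta - poly_T A' / poly_T B') = 2 * int (d n) + int (d (Suc n)) - 2"
      using theta_approximation_2 by blast
    have d: "d n < d (Suc n)" "2 \<le> d n"
      using length_V_ge[of "Suc n"] d_ge[of n] by (auto simp: d_Suc)
    \<comment> \<open>The two families approximate theta to different orders, because
      \<open>d n < d (Suc n)\<close>.\<close>
    have ne: "poly_T P / poly_T Q \<noteq> poly_T A' / poly_T B'"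
      using True e e' d by auto
    \<comment> \<open>A smaller \<open>?q\<close> would let the second family bound
      \<open>?e\<close> below its known value \<open>3 * d (Suc n) - 2\<close>.\<close>
    have "d (Suc n) \<le> ?q + 1"
    proof (rule ccontr)
      assume "\<not> ?thesis"
      then have lt: "int (degree B' + ?q) < 2 * int (d n) + int (d (Suc n)) - 2"
        using B'(2) d by linarith
      then have "?e \<le> int (degree B' + ?q)"
        using e' by (intro fls_subdegree_diff_fractions[OF B'(1) assms ne irr]) simp
      then show False
        using lt True e d by simp
    qed
    then show ?thesis
      using True e by simp
  qed
qed


section \<open>The irrationality measure\<close>

lemma absT_poly_T: "Q \<noteq> 0 \<Longrightarrow> absT b (poly_T Q) = b ^ degree Q"
  by (simp add: absT_def fls_subdegree_poly_T)

text \<open>The factor \<open>ln b\<close> cancels, leaving a ratio of degrees independent of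
  |T|.\<close>

lemma log_ratio:
  assumes "b > 1" "f \<noteq> 0" "Q \<noteq> 0"
  shows "- (ln (absT b f) / ln (absT b (poly_T Q))) = of_int (fls_subdegree f) / real (degree Q)"
proof -
  have "absT b f = b powr real_of_int (- fls_subdegree f)"
    using assms(1,2) by (subst powr_real_of_int') (simp_all add: absT_def)
  then have "ln (absT b f) = - of_int (fls_subdegree f) * ln b"
    using assms(1) by (simp add: ln_powr)
  moreover have "ln (absT b (poly_T Q)) = real (degree Q) * ln b"
    using assms(1,3) by (simp add: absT_poly_T ln_realpow)
  ultimately show ?thesis
    using assms(1) by simp
qed

lemma Limsup_le_filter: "F \<le> G \<Longrightarrow> Limsup F f \<le> Limsup G f"
  for f :: "'a \<Rightarrow> 'b::complete_lattice"
  unfolding Limsup_def by (rule INF_superset_mono) (auto dest: filter_leD)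

lemma irrationality_measure_le:
  assumes "b > 1" "f \<notin> rational_functions"
    and "\<And>P Q. Q \<noteq> 0 \<Longrightarrow> fls_subdegree (f - poly_T P / poly_T Q) \<le> k * int (degree Q) + c"
  shows "irrationality_measure b f \<le> ereal (of_int k)"
proof (rule ereal_le_epsilon2)
  fix \<epsilon> :: real
  assume "0 < \<epsilon>"
  \<comment> \<open>From degree \<open>N\<close> on, \<open>c\<close> is at most \<epsilon> times
    the degree; \<open>Suc\<close> keeps the degree positive for the division.\<close>
  define N where "N = Suc (nat \<lceil>of_int c / \<epsilon>\<rceil>)"
  have N: "of_int c / \<epsilon> \<le> real N"
    unfolding N_def by linarith
  have "ereal (- (ln (absT b (f - poly_T P / poly_T Q)) / ln (absT b (poly_T Q)))) \<le> ereal (of_int k + \<epsilon>)"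
    if PQ: "b ^ N \<le> absT b (poly_T Q)" for P Q
  proof -
    have "0 < absT b (poly_T Q)"
      using PQ assms(1) by (intro less_le_trans[OF _ PQ]) simp
    then have Q: "Q \<noteq> 0"
      by (auto simp: absT_def)
    then have "N \<le> degree Q"
      using PQ assms(1) by (simp add: absT_poly_T)
    then have q: "0 < real (degree Q)" "of_int c / \<epsilon> \<le> real (degree Q)"
      using N by (auto simp: N_def)
    have "f - poly_T P / poly_T Q \<noteq> 0"
      using assms(2) Q by (auto simp: rational_functions_def)
    then have eq: "- (ln (absT b (f - poly_T P / poly_T Q)) / ln (absT b (poly_T Q))) =
        of_int (fls_subdegree (f - poly_T P / poly_T Q)) / real (degree Q)"
      using assms(1) Q by (intro log_ratio)
    have "of_int (fls_subdegree (f - poly_T P / poly_T Q)) \<le> (of_int (k * int (degree Q) + c) :: real)"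
      using assms(3)[OF Q, of P] by (simp only: of_int_le_iff)
    also have "\<dots> \<le> (of_int k + \<epsilon>) * real (degree Q)"
      using q(2) \<open>0 < \<epsilon>\<close> by (simp add: field_simps)
    finally show ?thesis
      unfolding eq using q(1) by (simp add: field_simps)
  qed
  then show "irrationality_measure b f \<le> ereal (of_int k) + ereal \<epsilon>"
    unfolding irrationality_measure_def
    by (intro Limsup_bounded) (auto simp: eventually_filtercomap_at_top_linorder)
qed

text \<open>The denominators tend to infinity in absolute value, so the filter generated by the
  sequence of pairs is finer than the defining one, and the upper limit is monotone in the
  filter.\<close>

lemma irrationality_measure_ge:
  assumes "b > 1" "f \<notin> rational_functions"
    and "\<And>n. Q n \<noteq> 0" "filterlim (\<lambda>n. degree (Q n)) at_top sequentially"
    and "(\<lambda>n. of_int (fls_subdegree (f - poly_T (P n) / poly_T (Q n))) / real (degree (Q n))) \<longlonglongrightarrow> l"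
  shows "ereal l \<le> irrationality_measure b f"
proof -
  let ?F = "filtercomap (\<lambda>(P, Q). absT b (poly_T Q)) at_top"
  let ?r = "\<lambda>(P, Q). ereal (- (ln (absT b (f - poly_T P / poly_T Q)) / ln (absT b (poly_T Q))))"
  let ?s = "\<lambda>n. (P n, Q n)"
  have r: "?r (?s n) = ereal (of_int (fls_subdegree (f - poly_T (P n) / poly_T (Q n))) / real (degree (Q n)))" for n
  proof -
    have "f - poly_T (P n) / poly_T (Q n) \<noteq> 0"
      using assms(2,3) by (auto simp: rational_functions_def)
    then show ?thesis
      using log_ratio[OF assms(1) _ assms(3)] by simp
  qed
  have "Limsup sequentially (\<lambda>n. ?r (?s n)) = ereal l"
    unfolding r using assms(5) by (intro lim_imp_Limsup) simp_all
  then have "ereal l \<le> Limsup (filtermap ?s sequentially) ?r"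
    using Limsup_filtermap_ge[of sequentially ?r ?s] by simp
  also have "filtermap ?s sequentially \<le> ?F"
  proof -
    have "filterlim (\<lambda>n. b ^ degree (Q n)) at_top sequentially"
      using assms(1) filterlim_compose[OF filterlim_realpow_sequentially_gt1[of b] assms(4)]
      by (intro filterlim_at_infinity_imp_filterlim_at_top) simp_all
    then have "filterlim ?s ?F sequentially"
      using assms(3) by (simp add: filterlim_filtercomap_iff comp_def absT_poly_T)
    then show ?thesis
      by (simp add: filterlim_def)
  qed
  then have "Limsup (filtermap ?s sequentially) ?r \<le> Limsup ?F ?r"
    by (rule Limsup_le_filter)
  finally show ?thesis
    by (simp add: irrationality_measure_def)
qed

theorem corollary1:
  fixes b :: real
  assumes "b > 1"
  shows "theta \<notin> rational_functions \<and> irrationality_measure b theta = 3"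
proof (intro conjI antisym)
  show "theta \<notin> rational_functions"
    by (rule theta_irrational)
  show "irrationality_measure b theta \<le> 3"
    using irrationality_measure_le[OF assms theta_irrational theta_approximation_bound] by simp
  have "\<forall>n. \<exists>P Q. Q \<noteq> 0 \<and> degree Q = d (Suc n) \<and>
      fls_subdegree (theta - poly_T P / poly_T Q) = 3 * int (d (Suc n)) - 2"
    using theta_approximation_1 by blast
  then obtain P Q where PQ: "\<And>n. Q n \<noteq> 0" "\<And>n. degree (Q n) = d (Suc n)"
    "\<And>n. fls_subdegree (theta - poly_T (P n) / poly_T (Q n)) = 3 * int (d (Suc n)) - 2"
    by metis
  have lim: "filterlim (\<lambda>n. d (Suc n)) at_top sequentially"
  proof (rule filterlim_at_top_mono[OF filterlim_ident])
    show "\<forall>\<^sub>F n in sequentially. n \<le> d (Suc n)"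
    proof (rule always_eventually, rule allI)
      show "n \<le> d (Suc n)" for n
        using d_ge[of "Suc n"] by simp
    qed
  qed
  have "(\<lambda>n. 2 / real (d (Suc n))) \<longlonglongrightarrow> 0"
    by (intro tendsto_divide_0[OF tendsto_const] filterlim_at_top_imp_at_infinity
        filterlim_compose[OF filterlim_real_sequentially lim])
  \<comment> \<open>Along the first family the ratio is (3d - 2)/d = 3 - 2/d.\<close>
  then have "(\<lambda>n. 3 - 2 / real (d (Suc n))) \<longlonglongrightarrow> 3 - 0"
    by (intro tendsto_diff tendsto_const)
  moreover have "of_int (3 * int (d (Suc n)) - 2) / real (d (Suc n)) = 3 - 2 / real (d (Suc n))" for n
    using d_ge[of "Suc n"] by (simp add: field_simps)
  ultimately have "ereal 3 \<le> irrationality_measure b theta"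
    using PQ lim by (intro irrationality_measure_ge[OF assms theta_irrational, where P = P and Q = Q]) simp_all
  then show "3 \<le> irrationality_measure b theta"
    by simp
qed

end
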